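(* Let $\lambda,\mu\in\mathbb{R}$ be distinct and $\mathfrak{p}=\{(\lambda,3),(\mu,4)\}$. Then the set of block diagonal matrices $$\left\{\operatorname{diag}(\lambda\mathbb{I}_2,D,\mu\mathbb{I}_3)\ \Big|\ D=R_\alpha^{-1}\begin{pmatrix}\lambda&0\\0&\mu\end{pmatrix}R_\alpha,\ \alpha\in\left[0,\tfrac{\pi}{2}\right]\right\}$$ is a cross-section for $\mathrm{Sym}_{\mathfrak{p}}/\mathcal{G}_2$.
   Context: $R_\alpha=\begin{pmatrix}\cos\alpha&-\sin\alpha\\ \sin\alpha&\cos\alpha\end{pmatrix}$; $\operatorname{diag}(\cdot)$ denotes the block diagonal matrix with the listed blocks. Let $V$ be a 7-dimensional Euclidean space with a vector product $\pi$, i.e. a linear map $\pi:V\wedge V\to V$ such that $\{u,v,\pi(u\wedge v)\}$ is orthonormal whenever $\{u,v\}\subset V$ is. Write $xy=\pi(x\wedge y)$. Let $\mathcal{G}_2=\mathrm{Aut}(\pi)$ be the group of all orthogonal linear maps $g:V\to V$ with $g(xy)=g(x)g(y)$ for all $x,y\in V$. A Cayley triple is a triple $(u,v,z)\in V^3$ such that $\{u,v,uv,z\}$ is orthonormal; it determines an orthonormal basis $(u,v,uv,z,uz,vz,(uv)z)$ of $V$. Fix a Cayley triple $s$, and for a symmetric endomorphism $\delta$ of $V$ let $[\delta]_s$ be its matrix in the basis determined by $s$; $\delta\mapsto[\delta]_s$ is a bijection $\mathrm{Sym}(V)\to\mathrm{Sym}(\mathbb{R}^7)$ from symmetric endomorphisms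 of $V$ to real symmetric $7\times7$-matrices. $\mathcal{G}_2$ acts on $\mathrm{Sym}(\mathbb{R}^7)$ by $[\delta]_s\cdot g=[g^{-1}\delta g]_s$. For a symmetric matrix $\delta$ let $\mathfrak{p}(\delta)=\{(\lambda,\dim\mathcal{E}_\lambda(\delta))\mid\lambda\text{ an eigenvalue of }\delta\}$, where $\mathcal{E}_\lambda(\delta)$ is the eigenspace of $\lambda$, and for a set $\mathfrak{p}$ of such pairs let $\mathrm{Sym}_{\mathfrak{p}}=\{\delta\in\mathrm{Sym}(\mathbb{R}^7)\mid\mathfrak{p}(\delta)=\mathfrak{p}\}$, which is invariant under the action. A cross-section for $\mathrm{Sym}_{\mathfrak{p}}/\mathcal{G}_2$ is a subset of $\mathrm{Sym}_{\mathfrak{p}}$ containing exactly one element of each $\mathcal{G}_2$-orbit. $\mathbb{I}_n$ is the $n\times n$ identity matrix. *)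

theory Defs
  imports "HOL-Analysis.Analysis"
begin

text \<open>Stated for lists, so that an orthonormal family has no repeated members.\<close>

definition orthonormal :: "'v::real_inner list \<Rightarrow> bool" where
  "orthonormal xs \<longleftrightarrow>
     (\<forall>i<length xs. \<forall>j<length xs. xs ! i \<bullet> xs ! j = (if i = j then 1 else 0))"

text \<open>A linear map from the exterior square of \<open>V\<close> to \<open>V\<close> is encoded as an alternating bilinear map.\<close>

definition vector_product :: "('v::euclidean_space \<Rightarrow> 'v \<Rightarrow> 'v) \<Rightarrow> bool" where
  "vector_product m \<longleftrightarrow> bilinear m \<and> (\<forall>x. m x x = 0) \<and>
     (\<forall>u v. orthonormal [u, v] \<longrightarrow> orthonormal [u, v, m u v])"

definition G2 :: "('v::euclidean_space \<Rightarrow> 'v \<Rightarrow> 'v) \<Rightarrow> ('v \<Rightarrow> 'v) set" where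
  "G2 m = {g. orthogonal_transformation g \<and> (\<forall>x y. g (m x y) = m (g x) (g y))}"

definition cayley_triple :: "('v::euclidean_space \<Rightarrow> 'v \<Rightarrow> 'v) \<Rightarrow> 'v \<times> 'v \<times> 'v \<Rightarrow> bool" where
  "cayley_triple m = (\<lambda>(u, v, z). orthonormal [u, v, m u v, z])"

text \<open>
  The index type \<open>7\<close> consists of \<open>1, \<dots>, 6, 7 = 0\<close>; the function \<^const>\<open>vector\<close> places the
  members of its list at the positions \<open>1, \<dots>, 7\<close>.
\<close>

definition cayley_basis :: "('v::euclidean_space \<Rightarrow> 'v \<Rightarrow> 'v) \<Rightarrow> 'v \<times> 'v \<times> 'v \<Rightarrow> 'v ^ 7" where
  "cayley_basis m = (\<lambda>(u, v, z). vector [u, v, m u v, z, m u z, m v z, m (m u v) z])"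

definition Sym_endo :: "('v::euclidean_space \<Rightarrow> 'v) set" where
  "Sym_endo = {\<delta>. linear \<delta> \<and> (\<forall>x y. \<delta> x \<bullet> y = x \<bullet> \<delta> y)}"

definition Sym_mat :: "(real ^ 'n ^ 'n) set" where
  "Sym_mat = {A. transpose A = A}"

text \<open>Column \<open>j\<close> holds the coordinates of the image of the \<open>j\<close>-th vector of the basis \<open>b\<close>.\<close>

definition matrix_wrt :: "'v::euclidean_space ^ 'n \<Rightarrow> ('v \<Rightarrow> 'v) \<Rightarrow> real ^ 'n ^ 'n" where
  "matrix_wrt b \<delta> = (\<chi> i j. representation (range (($) b)) (\<delta> (b $ j)) (b $ i))"

text \<open>
  The orbit of \<open>A\<close> under the right action of \<open>G2 m\<close> on matrices that sends \<open>A = [\<delta>]\<close> to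
  \<open>[g\<^sup>-\<^sup>1 \<delta> g]\<close>, where the brackets denote the matrix with respect to the basis of \<open>s\<close>.
\<close>

definition G2_orbit ::
  "('v::euclidean_space \<Rightarrow> 'v \<Rightarrow> 'v) \<Rightarrow> 'v \<times> 'v \<times> 'v \<Rightarrow> real ^ 7 ^ 7 \<Rightarrow> (real ^ 7 ^ 7) set" where
  "G2_orbit m s A =
     {matrix_wrt (cayley_basis m s) (inv g \<circ> \<delta> \<circ> g) | \<delta> g.
        \<delta> \<in> Sym_endo \<and> g \<in> G2 m \<and> matrix_wrt (cayley_basis m s) \<delta> = A}"

definition eigenspace :: "real ^ 'n ^ 'n \<Rightarrow> real \<Rightarrow> (real ^ 'n) set" where
  "eigenspace A l = {x. A *v x = l *\<^sub>R x}"

definition eigenvalue :: "real ^ 'n ^ 'n \<Rightarrow> real \<Rightarrow> bool" where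
  "eigenvalue A l \<longleftrightarrow> (\<exists>x. x \<noteq> 0 \<and> A *v x = l *\<^sub>R x)"

definition eigen_pairs :: "real ^ 'n ^ 'n \<Rightarrow> (real \<times> nat) set" where
  "eigen_pairs A = {(l, dim (eigenspace A l)) | l. eigenvalue A l}"

definition Sym_pairs :: "(real \<times> nat) set \<Rightarrow> (real ^ 7 ^ 7) set" where
  "Sym_pairs P = {A \<in> Sym_mat. eigen_pairs A = P}"

definition cross_section ::
  "('v::euclidean_space \<Rightarrow> 'v \<Rightarrow> 'v) \<Rightarrow> 'v \<times> 'v \<times> 'v \<Rightarrow> (real \<times> nat) set \<Rightarrow>
     (real ^ 7 ^ 7) set \<Rightarrow> bool" where
  "cross_section m s P X \<longleftrightarrow>
     X \<subseteq> Sym_pairs P \<and> (\<forall>A \<in> Sym_pairs P. \<exists>!B. B \<in> X \<and> B \<in> G2_orbit m s A)"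

definition rot :: "real \<Rightarrow> real ^ 2 ^ 2" where
  "rot a = vector [vector [cos a, - sin a], vector [sin a, cos a]]"

text \<open>The block diagonal matrix with the blocks \<open>A\<close>, \<open>B\<close>, \<open>C\<close> of sizes 2, 2, 3.\<close>

definition block_diag :: "real ^ 2 ^ 2 \<Rightarrow> real ^ 2 ^ 2 \<Rightarrow> real ^ 3 ^ 3 \<Rightarrow> real ^ 7 ^ 7" where
  "block_diag A B C = vector
     [vector [A$1$1, A$1$2, 0, 0, 0, 0, 0],
      vector [A$2$1, A$2$2, 0, 0, 0, 0, 0],
      vector [0, 0, B$1$1, B$1$2, 0, 0, 0],
      vector [0, 0, B$2$1, B$2$2, 0, 0, 0],
      vector [0, 0, 0, 0, C$1$1, C$1$2, C$1$3],
      vector [0, 0, 0, 0, C$2$1, C$2$2, C$2$3],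
      vector [0, 0, 0, 0, C$3$1, C$3$2, C$3$3]]"

end

theory Submission
  imports Defs
begin

text \<open>
A symmetric map with eigenvalues \<open>lam\<close> of multiplicity 3 and \<open>mu\<close> of multiplicity 4 is
determined by its \<open>lam\<close>-eigenspace \<open>E\<close>, so the task is to classify the three-dimensional
subspaces of \<open>V\<close> up to automorphisms of the vector product.

The trilinear form \<open>m x y \<bullet> z\<close> is alternating. On an orthonormal basis of \<open>E\<close> its square is
therefore independent of the basis, since a change of basis multiplies the value by a determinant
\<open>\<plusminus>1\<close> (\<open>spectral_map_triple_invariant\<close>); automorphisms preserve it as well. On the space spanned by
\<open>u\<close>, \<open>v\<close> and \<open>cos \<alpha> uv - sin \<alpha> z\<close>, the \<open>lam\<close>-eigenspace of the block diagonal matrix with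
parameter \<open>\<alpha>\<close>, the value is \<open>cos \<alpha>\<close>. As the cosine is nonnegative and injective on \<open>[0, pi/2]\<close>, an
orbit contains at most one of these matrices.

Conversely, let \<open>e1, e2, e3\<close> be an orthonormal basis of \<open>E\<close>. Up to sign, \<open>e3\<close> is
\<open>cos \<alpha> e1 e2 - sin \<alpha> z'\<close>, where \<open>(e1, e2, z')\<close> is a Cayley triple (\<open>exists_rep_triple\<close>). All
products of members of a Cayley basis are, up to sign, again members, in a pattern that does not
depend on the triple. So the linear map that carries one Cayley basis to another is an automorphism
(\<open>cayley_automorphism\<close>), and some automorphism takes the span of \<open>u\<close>, \<open>v\<close>, \<open>cos \<alpha> uv - sin \<alpha> z\<close>
to \<open>E\<close>.
\<close>

section \<open>Vectors indexed by the seven-element type\<close>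

lemma UNIV_7: "(UNIV :: 7 set) = {1, 2, 3, 4, 5, 6, 7}"
proof -
  have "x \<in> {1, 2, 3, 4, 5, 6, 7}" for x :: 7
  proof (induct x)
    case (of_int z)
    then have "z = 0 \<or> z = 1 \<or> z = 2 \<or> z = 3 \<or> z = 4 \<or> z = 5 \<or> z = 6" by auto
    then show ?case by auto
  qed
  then show ?thesis by blast
qed

lemma forall_7: "(\<forall>i::7. P i) \<longleftrightarrow> P 1 \<and> P 2 \<and> P 3 \<and> P 4 \<and> P 5 \<and> P 6 \<and> P 7"
  using UNIV_7 by (metis UNIV_I insertE empty_iff)

lemma vector_7 [simp]:
  "(vector [a, b, c, d, e, f, g] :: 'a::zero ^ 7) $ 1 = a"
  "(vector [a, b, c, d, e, f, g] :: 'a::zero ^ 7) $ 2 = b"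
  "(vector [a, b, c, d, e, f, g] :: 'a::zero ^ 7) $ 3 = c"
  "(vector [a, b, c, d, e, f, g] :: 'a::zero ^ 7) $ 4 = d"
  "(vector [a, b, c, d, e, f, g] :: 'a::zero ^ 7) $ 5 = e"
  "(vector [a, b, c, d, e, f, g] :: 'a::zero ^ 7) $ 6 = f"
  "(vector [a, b, c, d, e, f, g] :: 'a::zero ^ 7) $ 7 = g"
  unfolding vector_def by simp_all

section \<open>Identities for vector products\<close>

lemma orthonormal_2: "orthonormal [u, v] \<longleftrightarrow> u \<bullet> u = 1 \<and> v \<bullet> v = 1 \<and> u \<bullet> v = 0"
  by (simp add: orthonormal_def All_less_Suc2 inner_commute conj_ac cong: conj_cong)

lemma orthonormal_3:
  "orthonormal [u, v, w] \<longleftrightarrow>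
     u \<bullet> u = 1 \<and> v \<bullet> v = 1 \<and> w \<bullet> w = 1 \<and> u \<bullet> v = 0 \<and> u \<bullet> w = 0 \<and> v \<bullet> w = 0"
  by (simp add: orthonormal_def All_less_Suc2 inner_commute conj_ac cong: conj_cong)

lemma orthonormal_4:
  "orthonormal [u, v, w, z] \<longleftrightarrow>
     u \<bullet> u = 1 \<and> v \<bullet> v = 1 \<and> w \<bullet> w = 1 \<and> z \<bullet> z = 1 \<and>
     u \<bullet> v = 0 \<and> u \<bullet> w = 0 \<and> v \<bullet> w = 0 \<and> u \<bullet> z = 0 \<and> v \<bullet> z = 0 \<and> w \<bullet> z = 0"
  by (simp add: orthonormal_def All_less_Suc2 inner_commute conj_ac cong: conj_cong)

context
  fixes m :: "'v::euclidean_space \<Rightarrow> 'v \<Rightarrow> 'v"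
  assumes vp: "vector_product m"
begin

lemma bilin: "bilinear m" and self_zero [simp]: "m x x = 0"
  using vp by (auto simp: vector_product_def)

lemmas bilin_simps =
  bilinear_ladd [OF bilin] bilinear_radd [OF bilin] bilinear_lsub [OF bilin] bilinear_rsub [OF bilin]
  bilinear_lmul [OF bilin] bilinear_rmul [OF bilin] bilinear_lneg [OF bilin] bilinear_rneg [OF bilin]
  bilinear_lzero [OF bilin] bilinear_rzero [OF bilin]

lemma anticommute: "m y x = - m x y"
proof -
  have "m (x + y) (x + y) = 0" by simp
  then have "m x y + m y x = 0"
    using self_zero[of x] self_zero[of y] by (simp del: self_zero add: bilin_simps add.commute)
  then show ?thesis by (simp add: eq_neg_iff_add_eq_0 add.commute)
qed

text \<open>
Both claims hold for orthonormal pairs by definition. In general only the component of \<open>y\<close>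
orthogonal to \<open>x\<close> contributes to the product, so bilinearity reduces to that case.
\<close>

lemma product_orthogonal_and_square:
  "m x y \<bullet> x = 0 \<and> m x y \<bullet> m x y = (x \<bullet> x) * (y \<bullet> y) - (x \<bullet> y)\<^sup>2"
proof (cases "x = 0")
  case True
  then show ?thesis by (simp add: bilin_simps)
next
  case x: False
  define a where "a = x /\<^sub>R norm x"
  define y' where "y' = y - (y \<bullet> a) *\<^sub>R a"
  have aa: "a \<bullet> a = 1" using x by (simp add: a_def dot_square_norm field_simps power2_eq_square)
  have xa: "x = norm x *\<^sub>R a" using x by (simp add: a_def)
  have ya: "y = (y \<bullet> a) *\<^sub>R a + y'" by (simp add: y'_def)
  have ay: "a \<bullet> y' = 0" using aa by (simp add: y'_def inner_diff_right inner_commute)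
  show ?thesis
  proof (cases "y' = 0")
    case True
    then obtain p q where "x = p *\<^sub>R a" "y = q *\<^sub>R a" using xa ya by (metis add.right_neutral)
    then show ?thesis using aa by (simp add: bilin_simps power2_eq_square)
  next
    case y': False
    define b where "b = y' /\<^sub>R norm y'"
    have bb: "b \<bullet> b = 1" using y' by (simp add: b_def dot_square_norm field_simps power2_eq_square)
    have ab: "a \<bullet> b = 0" using ay by (simp add: b_def)
    have yb: "y' = norm y' *\<^sub>R b" using y' by (simp add: b_def)
    obtain p q r where xp: "x = p *\<^sub>R a" and yq: "y = q *\<^sub>R a + r *\<^sub>R b"
      using xa ya yb by metis
    have "orthonormal [a, b, m a b]"
      using vp aa bb ab by (simp add: vector_product_def orthonormal_2)
    then show ?thesis unfolding xp yq
      by (simp add: orthonormal_3 bilin_simps inner_simps inner_commute power2_eq_square algebra_simps)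
  qed
qed

text \<open>
The form \<open>m x y \<bullet> z\<close> vanishes when its outer arguments coincide; polarization turns this into
antisymmetry.
\<close>

lemma triple_swap_13: "m x y \<bullet> z = - (m z y \<bullet> x)"
proof -
  have eq: "m (x + z) y \<bullet> (x + z) = m x y \<bullet> x + m z y \<bullet> z + (m x y \<bullet> z + m z y \<bullet> x)"
    by (simp add: bilin_simps inner_simps)
  show ?thesis
    using eq product_orthogonal_and_square[of "x + z" y] product_orthogonal_and_square[of x y]
      product_orthogonal_and_square[of z y] by linarith
qed

lemma triple_swap_12: "m x y \<bullet> z = - (m y x \<bullet> z)"
  by (subst anticommute) simp

lemma triple_swap_23: "m x y \<bullet> z = - (m x z \<bullet> y)"
  using triple_swap_12[of x y z] triple_swap_13[of y x z] triple_swap_12[of z x y] by simp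

lemma product_orthogonal: "m x y \<bullet> x = 0" "m x y \<bullet> y = 0"
  using product_orthogonal_and_square triple_swap_12[of x y y] by simp_all

text \<open>
Polarization of the formula for the square of a product.
\<close>

lemma inner_product_product: "m x y \<bullet> m x z = (x \<bullet> x) * (y \<bullet> z) - (x \<bullet> y) * (x \<bullet> z)"
proof -
  have eq: "m x (y + z) \<bullet> m x (y + z) = m x y \<bullet> m x y + m x z \<bullet> m x z + 2 * (m x y \<bullet> m x z)"
    by (simp add: bilin_simps inner_simps inner_commute)
  have "2 * (m x y \<bullet> m x z) = 2 * ((x \<bullet> x) * (y \<bullet> z) - (x \<bullet> y) * (x \<bullet> z))"
    using eq
    unfolding product_orthogonal_and_square[THEN conjunct2]
    by (simp add: inner_simps inner_commute power2_eq_square algebra_simps)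
  then show ?thesis by simp
qed

text \<open>
Left multiplication by \<open>x\<close> is skew-symmetric, so its square is read off from the inner product of
two products with left factor \<open>x\<close>.
\<close>

lemma double_product: "m x (m x y) = (x \<bullet> y) *\<^sub>R x - (x \<bullet> x) *\<^sub>R y"
proof (rule vector_eq_rdot[THEN iffD1], rule allI)
  fix z
  have "m x (m x y) \<bullet> z = - (m x y \<bullet> m x z)"
    using triple_swap_23[of x "m x y" z] by (simp add: inner_commute)
  then show "m x (m x y) \<bullet> z = ((x \<bullet> y) *\<^sub>R x - (x \<bullet> x) *\<^sub>R y) \<bullet> z"
    by (simp add: inner_product_product inner_simps)
qed

text \<open>
This is the polarization of the formula for the double product, in which orthogonality removes
every term that is not a product.
\<close>

lemma orthogonal_antiassociative:
  assumes "x \<bullet> y = 0" "x \<bullet> z = 0" "y \<bullet> z = 0"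
  shows "m x (m y z) = - m (m x y) z"
proof -
  have eq: "m (x + z) (m (x + z) y) = m x (m x y) + m z (m z y) + (m x (m z y) + m z (m x y))"
    by (simp add: bilin_simps)
  have "m x (m z y) + m z (m x y) = 0"
    using eq assms by (simp add: double_product inner_simps inner_commute algebra_simps)
  then have "m x (m z y) = m (m x y) z"
    by (simp add: anticommute[of z "m x y"])
  then show ?thesis
    by (simp add: anticommute[of y z] bilin_simps)
qed

text \<open>
Antiassociativity regroups the product so that \<open>m p z\<close> is multiplied by \<open>z\<close> first, and
\<open>m (m p z) z = - p\<close>.
\<close>

lemma product_pair_common_factor:
  assumes "p \<bullet> q = 0" "p \<bullet> z = 0" "q \<bullet> z = 0" "m p q \<bullet> z = 0" "z \<bullet> z = 1"
  shows "m (m p z) (m q z) = - m p q"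
proof -
  have 1: "m p z \<bullet> z = 0" by (rule product_orthogonal)
  have 2: "m p z \<bullet> q = 0" using assms(4) triple_swap_23[of p z q] by simp
  have 3: "m (m p z) z = - p"
    using double_product[of z p] assms(2,5)
    by (simp add: anticommute[of "m z p" z] anticommute[of p z] inner_commute[of z p] bilin_simps)
  have "m (m p z) (m q z) = - m (m p z) (m z q)"
    by (simp add: anticommute[of z q] bilin_simps)
  also have "\<dots> = m (m (m p z) z) q"
    using orthogonal_antiassociative[of "m p z" z q] 1 2 assms(3) by (simp add: inner_commute)
  finally show ?thesis using 3 by (simp add: bilin_simps)
qed

text \<open>
The multiplication table of the Cayley basis above the diagonal, apart from those products that
are themselves members of the basis by definition. What matters is that every right-hand side is
the same expression in the basis for all triples.
\<close>

lemma cayley_table_upper: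
  assumes "cayley_triple m (u, v, z)"
  defines "w \<equiv> m u v"
  shows "m u w = - v" "m v w = u"
    "m u (m u z) = - z" "m u (m v z) = - m w z" "m u (m w z) = m v z"
    "m v (m u z) = m w z" "m v (m v z) = - z" "m v (m w z) = - m u z"
    "m w (m u z) = - m v z" "m w (m v z) = m u z" "m w (m w z) = - z"
    "m z (m u z) = u" "m z (m v z) = v" "m z (m w z) = w"
    "m (m u z) (m v z) = - w" "m (m u z) (m w z) = v" "m (m v z) (m w z) = - u"
proof -
  have on: "u \<bullet> u = 1" "v \<bullet> v = 1" "w \<bullet> w = 1" "z \<bullet> z = 1"
     "u \<bullet> v = 0" "u \<bullet> w = 0" "v \<bullet> w = 0" "u \<bullet> z = 0" "v \<bullet> z = 0" "w \<bullet> z = 0"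
    using assms(1) by (simp_all add: cayley_triple_def orthonormal_4 w_def)
  then have no: "v \<bullet> u = 0" "w \<bullet> u = 0" "w \<bullet> v = 0" "z \<bullet> u = 0" "z \<bullet> v = 0" "z \<bullet> w = 0"
    by (simp_all add: inner_commute)
  have uv: "m u v = w" by (simp add: w_def)
  show uw: "m u w = - v" using double_product[of u v] on by (simp add: w_def)
  have vu: "m v u = - w" using uv by (simp add: anticommute[of v u])
  have "m v w = - m v (m v u)" by (simp add: vu bilin_simps)
  then show vw: "m v w = u" using double_product[of v u] on no by simp
  have wu: "m w u = v" "m w v = - u" using uw vw anticommute[of w u] anticommute[of w v] by simp_all
  show "m u (m u z) = - z" "m v (m v z) = - z" "m w (m w z) = - z"
    using on by (simp_all add: double_product)
  show "m u (m v z) = - m w z" "m u (m w z) = m v z" "m v (m u z) = m w z" 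
     "m v (m w z) = - m u z" "m w (m u z) = - m v z" "m w (m v z) = m u z"
    using orthogonal_antiassociative[of u v z] orthogonal_antiassociative[of u w z]
      orthogonal_antiassociative[of v u z] orthogonal_antiassociative[of v w z]
      orthogonal_antiassociative[of w u z] orthogonal_antiassociative[of w v z]
    by (simp_all add: on no uv uw vw vu wu bilin_simps)
  show "m z (m u z) = u" "m z (m v z) = v" "m z (m w z) = w"
    using on no by (simp_all add: double_product anticommute[of u z] anticommute[of v z] anticommute[of w z] bilin_simps)
  show "m (m u z) (m v z) = - w" "m (m u z) (m w z) = v" "m (m v z) (m w z) = - u"
    using product_pair_common_factor[of u v z] product_pair_common_factor[of u w z]
      product_pair_common_factor[of v w z]
    by (simp_all add: on no uv uw vw)
qed

end

section \<open>Orthonormal families and matrices\<close>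

text \<open>
Families are indexed by a finite type, as \<^const>\<open>cayley_basis\<close> is; the family need not span, which
allows the same notion for bases of \<open>V\<close> and of eigenspaces.
\<close>

definition orthonormal_vec :: "'v::euclidean_space ^ 'n \<Rightarrow> bool" where
  "orthonormal_vec b \<longleftrightarrow> (\<forall>i j. b $ i \<bullet> b $ j = (if i = j then 1 else 0))"

lemma orthonormal_vec_inner: "orthonormal_vec b \<Longrightarrow> b $ i \<bullet> b $ j = (if i = j then 1 else 0)"
  by (simp add: orthonormal_vec_def)

lemma orthonormal_vec_inner_sum:
  assumes "orthonormal_vec b" shows "(\<Sum>k\<in>UNIV. f k *\<^sub>R b $ k) \<bullet> b $ i = f i"
  using assms by (simp add: inner_sum_left orthonormal_vec_inner if_distrib cong: if_cong)

lemma orthonormal_vec_independent: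
  fixes b :: "'v::euclidean_space ^ 'n"
  assumes "orthonormal_vec b"
  shows "inj (($) b)" and "independent (range (($) b))"
proof -
  show inj: "inj (($) b)"
    using orthonormal_vec_inner[OF assms] by (intro injI) (metis zero_neq_one)
  have "pairwise orthogonal (range (($) b))"
    using orthonormal_vec_inner[OF assms] by (auto simp: pairwise_def orthogonal_def)
  moreover have "0 \<notin> range (($) b)"
    using orthonormal_vec_inner[OF assms] by (metis imageE inner_zero_left zero_neq_one)
  ultimately show "independent (range (($) b))"
    by (intro pairwise_orthogonal_independent)
qed

lemma dim_span_orthonormal_vec:
  fixes b :: "'v::euclidean_space ^ 'n"
  assumes "orthonormal_vec b" shows "dim (span (range (($) b))) = CARD('n)"
  using orthonormal_vec_independent[OF assms] by (simp add: dim_eq_card_independent card_image)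

lemma orthonormal_vec_spans:
  fixes b :: "'v::euclidean_space ^ 'n"
  assumes "orthonormal_vec b" and "DIM('v) = CARD('n)"
  shows "span (range (($) b)) = UNIV"
  using dim_span_orthonormal_vec[OF assms(1)] assms(2) by (metis dim_eq_full span_span)

lemma orthonormal_vec_expansion:
  fixes b :: "'v::euclidean_space ^ 'n"
  assumes "orthonormal_vec b" and "x \<in> span (range (($) b))"
  shows "(\<Sum>k\<in>UNIV. (x \<bullet> b $ k) *\<^sub>R b $ k) = x"
  using assms(2)
proof (induction rule: span_induct_alt)
  case (step c y z)
  then obtain i where y: "y = b $ i" by blast
  have "(y \<bullet> b $ k) *\<^sub>R b $ k = (if k = i then y else 0)" for k
    using assms(1) by (simp add: y orthonormal_vec_inner)
  then have "(\<Sum>k\<in>UNIV. (y \<bullet> b $ k) *\<^sub>R b $ k) = y" by simp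
  then show ?case using step(2)
    by (simp add: inner_add_left scaleR_add_left sum.distrib
        flip: scaleR_scaleR scaleR_sum_right)
qed simp

lemma orthonormal_vec_eqI:
  fixes b :: "'v::euclidean_space ^ 'n"
  assumes "orthonormal_vec b" and "DIM('v) = CARD('n)" and "\<And>i. x \<bullet> b $ i = y \<bullet> b $ i"
  shows "x = y"
  using orthonormal_vec_expansion[OF assms(1)] orthonormal_vec_spans[OF assms(1,2)] assms(3) by (metis (no_types, lifting) UNIV_I sum.cong)

lemma orthonormal_vec_parseval:
  fixes b :: "'v::euclidean_space ^ 'n"
  assumes "orthonormal_vec b" and "DIM('v) = CARD('n)"
  shows "(\<Sum>k\<in>UNIV. (x \<bullet> b $ k) * (y \<bullet> b $ k)) = x \<bullet> y"
proof -
  have "x \<bullet> y = (\<Sum>k\<in>UNIV. (x \<bullet> b $ k) *\<^sub>R b $ k) \<bullet> y"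
    using assms by (simp add: orthonormal_vec_expansion orthonormal_vec_spans)
  then show ?thesis by (simp add: inner_sum_left inner_commute[of "b $ _" y])
qed

lemma matrix_wrt_orthonormal:
  fixes b :: "'v::euclidean_space ^ 'n"
  assumes "orthonormal_vec b" and "DIM('v) = CARD('n)"
  shows "matrix_wrt b f $ i $ j = f (b $ j) \<bullet> b $ i"
proof -
  let ?B = "range (($) b)"
  have ind: "independent ?B" and inj: "inj (($) b)" using orthonormal_vec_independent[OF assms(1)] by auto
  have sp: "x \<in> span ?B" for x using orthonormal_vec_spans[OF assms] by simp
  have "(\<Sum>k\<in>UNIV. representation ?B x (b $ k) *\<^sub>R b $ k) = x" for x
    using sum_representation_eq[OF ind sp, of ?B x] inj by (simp add: sum.reindex)
  then have "representation ?B x (b $ i) = x \<bullet> b $ i" for x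
    using orthonormal_vec_inner_sum[OF assms(1)] by metis
  then show ?thesis by (simp add: matrix_wrt_def)
qed

lemma matrix_wrt_inject:
  fixes b :: "'v::euclidean_space ^ 'n"
  assumes "orthonormal_vec b" and "DIM('v) = CARD('n)" and "linear f" and "linear g"
    and "matrix_wrt b f = matrix_wrt b g"
  shows "f = g"
proof
  fix x
  have "f (b $ j) = g (b $ j)" for j
    using orthonormal_vec_eqI[OF assms(1,2)] matrix_wrt_orthonormal[OF assms(1,2)] assms(5) by metis
  then show "f x = g x"
    using linear_eq_on_span[OF assms(3,4), of "range (($) b)"] orthonormal_vec_spans[OF assms(1,2)] by blast
qed

lemma matrix_wrt_Sym_endo:
  fixes b :: "'v::euclidean_space ^ 'n"
  assumes "orthonormal_vec b" and "DIM('v) = CARD('n)" and "\<delta> \<in> Sym_endo"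
  shows "matrix_wrt b \<delta> \<in> Sym_mat"
proof -
  have "\<delta> (b $ i) \<bullet> b $ j = \<delta> (b $ j) \<bullet> b $ i" for i j
    using assms(3) inner_commute[of "b $ i"] by (simp add: Sym_endo_def)
  then show ?thesis
    by (simp add: Sym_mat_def vec_eq_iff transpose_def matrix_wrt_orthonormal[OF assms(1,2)])
qed

section \<open>Symmetric maps with two eigenvalues\<close>

text \<open>
The map with eigenvalue \<open>lam\<close> on the span of the orthonormal family \<open>e\<close> and \<open>mu\<close> on its orthogonal
complement. Writing it in terms of \<open>e\<close> makes conjugation and passage to coordinates act on \<open>e\<close>
alone.
\<close>

definition spectral_map :: "real \<Rightarrow> real \<Rightarrow> 'v::euclidean_space ^ 'k \<Rightarrow> 'v \<Rightarrow> 'v" where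
  "spectral_map lam mu e x = mu *\<^sub>R x + (lam - mu) *\<^sub>R (\<Sum>k\<in>UNIV. (x \<bullet> e $ k) *\<^sub>R e $ k)"

lemma linear_spectral_map: "linear (spectral_map lam mu e)"
  by (rule linearI)
    (simp_all add: spectral_map_def inner_add_left scaleR_add_left scaleR_add_right sum.distrib scaleR_sum_right ac_simps)

lemma inner_spectral_map:
  "spectral_map lam mu e x \<bullet> y = mu * (x \<bullet> y) + (lam - mu) * (\<Sum>k\<in>UNIV. (e $ k \<bullet> x) * (e $ k \<bullet> y))"
  by (simp add: spectral_map_def inner_add_left inner_sum_left inner_commute[of x "e $ _"])

lemma spectral_map_Sym_endo: "spectral_map lam mu e \<in> Sym_endo"
proof -
  have "spectral_map lam mu e x \<bullet> y = spectral_map lam mu e y \<bullet> x" for x y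
    by (simp add: inner_spectral_map inner_commute[of x y] mult.commute)
  then have "spectral_map lam mu e x \<bullet> y = x \<bullet> spectral_map lam mu e y" for x y
    by (rule trans) (rule inner_commute)
  then show ?thesis
    by (simp add: Sym_endo_def linear_spectral_map)
qed

lemma spectral_map_conjugate:
  fixes g :: "'v::euclidean_space \<Rightarrow> 'v"
  assumes "orthogonal_transformation g"
  shows "inv g \<circ> spectral_map lam mu e \<circ> g = spectral_map lam mu (\<chi> k. inv g (e $ k))"
proof
  fix x
  have surj: "g (inv g y) = y" for y
    using orthogonal_transformation_surj[OF assms] by (simp add: surj_f_inv_f)
  have inv: "inv g (g y) = y" for y
    by (rule inv_f_f[OF orthogonal_transformation_inj[OF assms]])
  have lin: "linear (inv g)"
    by (rule orthogonal_transformation_linear[OF orthogonal_transformation_inv[OF assms]])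
  have "g x \<bullet> y = x \<bullet> inv g y" for y
  proof -
    have "g x \<bullet> g (inv g y) = x \<bullet> inv g y"
      using assms by (simp add: orthogonal_transformation_def)
    then show ?thesis by (simp add: surj)
  qed
  then show "(inv g \<circ> spectral_map lam mu e \<circ> g) x = spectral_map lam mu (\<chi> k. inv g (e $ k)) x"
    by (simp add: spectral_map_def linear_add[OF lin] linear_scale[OF lin] linear_sum[OF lin] inv)
qed

lemma spectral_map_projection_eq:
  assumes "lam \<noteq> mu" "spectral_map lam mu e = spectral_map lam mu f"
  shows "(\<Sum>k\<in>UNIV. (x \<bullet> e $ k) *\<^sub>R e $ k) = (\<Sum>k\<in>UNIV. (x \<bullet> f $ k) *\<^sub>R f $ k)"
  using assms(1) fun_cong[OF assms(2), of x] by (simp add: spectral_map_def)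

text \<open>
In an orthonormal basis only \<open>e\<close> has to be replaced by its coordinates. Statements about the
eigenspaces of matrices thereby become statements about orthonormal families in \<open>V\<close>, and back.
\<close>

lemma matrix_wrt_spectral_map:
  fixes b :: "'v::euclidean_space ^ 'n" and e :: "'v ^ 'k"
  assumes "orthonormal_vec b" and "DIM('v) = CARD('n)"
  shows "matrix_wrt b (spectral_map lam mu e) =
    matrix (spectral_map lam mu (\<chi> k i. e $ k \<bullet> b $ i))"
proof -
  let ?e = "\<chi> k i. e $ k \<bullet> b $ i"
  have "matrix (spectral_map lam mu ?e) $ i $ j = mu * (axis j 1 \<bullet> (axis i 1 :: real ^ 'n)) +
      (lam - mu) * (\<Sum>k\<in>UNIV. (?e $ k \<bullet> axis j 1) * (?e $ k \<bullet> axis i 1))" for i j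
    unfolding inner_spectral_map[symmetric] by (simp add: matrix_def inner_axis)
  moreover have "axis j 1 \<bullet> (axis i 1 :: real ^ 'n) = (if j = i then 1 else 0)" for i j
    by (simp add: inner_axis_axis)
  moreover have "?e $ k \<bullet> axis j 1 = e $ k \<bullet> b $ j" for k j
    by (simp add: inner_axis)
  ultimately show ?thesis
    by (simp only: vec_eq_iff matrix_wrt_orthonormal[OF assms] inner_spectral_map orthonormal_vec_inner[OF assms(1)])
      simp
qed

lemma orthonormal_vec_coordinates:
  fixes b :: "'v::euclidean_space ^ 'n" and e :: "'v ^ 'k"
  assumes "orthonormal_vec b" and "DIM('v) = CARD('n)"
  shows "orthonormal_vec (\<chi> k i. e $ k \<bullet> b $ i) \<longleftrightarrow> orthonormal_vec e"
  by (simp add: orthonormal_vec_def inner_vec_def orthonormal_vec_parseval[OF assms])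

text \<open>
For an eigenvalue \<open>l \<noteq> mu\<close>, the equation \<open>(l - mu) x = (lam - mu) P x\<close>, where \<open>P\<close> is the projection
onto the span of \<open>e\<close>, puts \<open>x\<close> into that span and hence forces \<open>l = lam\<close>.
\<close>

lemma eigen_pairs_matrix_spectral_map:
  fixes e :: "(real ^ 'n) ^ 'k"
  assumes "orthonormal_vec e" and "lam \<noteq> mu" and "CARD('k) < CARD('n)"
  shows "eigen_pairs (matrix (spectral_map lam mu e)) = {(lam, CARD('k)), (mu, CARD('n) - CARD('k))}"
proof -
  let ?A = "matrix (spectral_map lam mu e)" and ?P = "\<lambda>x. \<Sum>k\<in>UNIV. (x \<bullet> e $ k) *\<^sub>R e $ k"
  let ?E = "span (range (($) e))"
  have A: "?A *v x = mu *\<^sub>R x + (lam - mu) *\<^sub>R ?P x" for x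
    by (simp add: matrix_works linear_spectral_map spectral_map_def)
  have PE: "?P x \<in> ?E" for x by (intro span_sum span_scale span_base) auto
  have "?A *v x = lam *\<^sub>R x \<longleftrightarrow> (lam - mu) *\<^sub>R ?P x = (lam - mu) *\<^sub>R x" for x
    unfolding A by (auto simp: scaleR_diff_left algebra_simps)
  then have "?A *v x = lam *\<^sub>R x \<longleftrightarrow> x \<in> ?E" for x
    using assms PE[of x] orthonormal_vec_expansion[OF assms(1), of x] by auto
  then have lamE: "eigenspace ?A lam = ?E" by (auto simp: eigenspace_def)
  have P0: "?P x = 0 \<longleftrightarrow> (\<forall>y\<in>?E. orthogonal y x)" for x
  proof
    assume "?P x = 0"
    then have "x \<bullet> e $ k = 0" for k
      using orthonormal_vec_inner_sum[OF assms(1), of "\<lambda>k. x \<bullet> e $ k" k] by simp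
    then have "orthogonal x y" if "y \<in> ?E" for y
      using orthogonal_to_span[OF that, of x] by (auto simp: orthogonal_def)
    then show "\<forall>y\<in>?E. orthogonal y x" by (simp add: orthogonal_commute)
  next
    assume "\<forall>y\<in>?E. orthogonal y x"
    then have "x \<bullet> e $ k = 0" for k
      using span_base[of "e $ k" "range (($) e)"] by (auto simp: orthogonal_def inner_commute)
    then show "?P x = 0" by simp
  qed
  have muE: "eigenspace ?A mu = {x \<in> UNIV. \<forall>y\<in>?E. orthogonal y x}"
    using assms(2) by (auto simp: eigenspace_def A P0[symmetric])
  have dlam: "dim (eigenspace ?A lam) = CARD('k)" by (simp only: lamE dim_span_orthonormal_vec[OF assms(1)])
  have "dim (eigenspace ?A mu) + dim ?E = dim (UNIV :: (real ^ 'n) set)"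
    unfolding muE by (rule dim_subspace_orthogonal_to_vectors) auto
  then have dmu: "dim (eigenspace ?A mu) = CARD('n) - CARD('k)"
    using dim_span_orthonormal_vec[OF assms(1)] by simp
  have ev: "eigenvalue A l" if "dim (eigenspace A l) > 0" for A :: "real ^ 'n ^ 'n" and l
  proof (rule ccontr)
    assume "\<not> eigenvalue A l"
    then have "eigenspace A l \<subseteq> {0}" by (auto simp: eigenvalue_def eigenspace_def)
    then have "dim (eigenspace A l) = 0" by simp
    with that show False by simp
  qed
  have "l = lam \<or> l = mu" if l: "eigenvalue ?A l" for l
  proof -
    obtain x where x: "x \<noteq> 0" "?A *v x = l *\<^sub>R x" using l by (auto simp: eigenvalue_def)
    have eq: "(l - mu) *\<^sub>R x = (lam - mu) *\<^sub>R ?P x"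
      using x(2) unfolding A by (simp add: scaleR_diff_left algebra_simps)
    show ?thesis
    proof (cases "l = mu")
      case False
      then have xeq: "x = (1 / (l - mu)) *\<^sub>R ((lam - mu) *\<^sub>R ?P x)"
        unfolding eq[symmetric] by simp
      have "(1 / (l - mu)) *\<^sub>R ((lam - mu) *\<^sub>R ?P x) \<in> ?E" by (intro span_scale PE)
      then have "x \<in> ?E" by (simp only: xeq[symmetric])
      then have "?P x = x" by (rule orthonormal_vec_expansion[OF assms(1)])
      then show ?thesis using eq x(1) by simp
    qed simp
  qed
  moreover have "eigenvalue ?A lam" "eigenvalue ?A mu"
    using dlam dmu assms(3) by (auto intro!: ev)
  ultimately show ?thesis
    using dlam dmu unfolding eigen_pairs_def by auto
qed

text \<open>
The eigenspaces of a symmetric matrix are orthogonal to each other. If two of them have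
complementary dimensions, each is the full orthogonal complement of the other, and every vector
splits into two eigenvectors.
\<close>

lemma symmetric_two_eigenspaces:
  fixes A :: "real ^ 'n ^ 'n"
  assumes "transpose A = A" and "lam \<noteq> mu"
    and dlam: "dim (eigenspace A lam) = CARD('k)"
    and dmu: "dim (eigenspace A mu) + CARD('k) = CARD('n)"
  obtains e :: "(real ^ 'n) ^ 'k" where "orthonormal_vec e" and "\<And>x. A *v x = spectral_map lam mu e x"
proof -
  let ?E = "eigenspace A lam" and ?F = "eigenspace A mu"
  have sub: "subspace (eigenspace A l)" for l
    by (auto simp: subspace_def eigenspace_def algebra_simps matrix_vector_mult_scaleR
      matrix_vector_right_distrib)
  obtain B where B: "B \<subseteq> ?E" "pairwise orthogonal B" "\<And>x. x \<in> B \<Longrightarrow> norm x = 1"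
    "independent B" "card B = dim ?E" "span B = ?E"
    using orthonormal_basis_subspace[OF sub] by metis
  have "finite B" using B(4) by (rule independent_imp_finite)
  then obtain h where h: "bij_betw h (UNIV :: 'k set) B"
    using B(5) dlam by (metis finite_same_card_bij finite)
  define e :: "(real ^ 'n) ^ 'k" where "e = (\<chi> k. h k)"
  have range: "range (($) e) = B" using h by (auto simp: e_def bij_betw_def)
  have "h i \<bullet> h j = (if i = j then 1 else 0)" for i j
  proof (cases "i = j")
    case True
    have "norm (h i) = 1" using B(3) h by (auto simp: bij_betw_def)
    then show ?thesis using True by (simp add: norm_eq_1)
  next
    case False
    then have "h i \<noteq> h j" using h by (auto simp: bij_betw_def inj_def)
    moreover have "h i \<in> B" "h j \<in> B" using h by (auto simp: bij_betw_def)
    ultimately show ?thesis using B(2) False by (auto simp: pairwise_def orthogonal_def)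
  qed
  then have e: "orthonormal_vec e" by (simp add: orthonormal_vec_def e_def)
  have orth: "orthogonal x y" if "x \<in> ?E" "y \<in> ?F" for x y
  proof -
    have "lam * (x \<bullet> y) = (A *v x) \<bullet> y" using that by (simp add: eigenspace_def)
    also have "\<dots> = x \<bullet> (A *v y)"
      using assms(1) by (metis dot_lmul_matrix vector_transpose_matrix)
    also have "\<dots> = mu * (x \<bullet> y)" using that by (simp add: eigenspace_def)
    finally show ?thesis using assms(2) by (simp add: orthogonal_def)
  qed
  have "?F = {y \<in> UNIV. \<forall>x\<in>?E. orthogonal x y}"
  proof (rule subspace_dim_equal)
    show "subspace {y \<in> UNIV. \<forall>x\<in>?E. orthogonal x y}"
      by (auto simp: subspace_def orthogonal_def inner_add_right)
    have "dim {y \<in> UNIV. \<forall>x\<in>?E. orthogonal x y} + dim ?E = dim (UNIV :: (real ^ 'n) set)"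
      by (rule dim_subspace_orthogonal_to_vectors) (auto simp: sub)
    then show "dim {y \<in> UNIV. \<forall>x\<in>?E. orthogonal x y} \<le> dim ?F"
      using dlam dmu by simp
  qed (use sub orth in auto)
  then have F: "y \<in> ?F" if "\<And>x. x \<in> ?E \<Longrightarrow> orthogonal x y" for y
    using that by blast
  have "A *v x = spectral_map lam mu e x" for x
  proof -
    define p where "p = (\<Sum>k\<in>UNIV. (x \<bullet> e $ k) *\<^sub>R e $ k)"
    have "p \<in> span (range (($) e))"
      unfolding p_def by (intro span_sum span_scale span_base) auto
    then have pE: "p \<in> ?E" using range B(6) by simp
    have "(x - p) \<bullet> e $ k = 0" for k
      using orthonormal_vec_inner_sum[OF e, of "\<lambda>k. x \<bullet> e $ k" k] by (simp add: p_def inner_diff_left)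
    then have "orthogonal (x - p) y" if "y \<in> B" for y
      using that range by (auto simp: orthogonal_def)
    then have "orthogonal y (x - p)" if "y \<in> ?E" for y
      using that B(6) orthogonal_to_span[of y B "x - p"] orthogonal_commute by metis
    then have "x - p \<in> ?F" by (rule F)
    then have "A *v (p + (x - p)) = lam *\<^sub>R p + mu *\<^sub>R (x - p)"
      using pE unfolding matrix_vector_right_distrib by (simp add: eigenspace_def)
    then show ?thesis by (simp add: spectral_map_def p_def[symmetric] algebra_simps)
  qed
  with e show thesis by (rule that)
qed

lemma Sym_pairs_spectral_map:
  fixes b :: "'v::euclidean_space ^ 7"
  assumes "orthonormal_vec b" and "DIM('v) = CARD(7)" and "A \<in> Sym_pairs {(lam, 3), (mu, 4)}" and "lam \<noteq> mu"
  obtains e :: "'v ^ 3" where "orthonormal_vec e" and "matrix_wrt b (spectral_map lam mu e) = A"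
proof -
  have sym: "transpose A = A" and ep: "eigen_pairs A = {(lam, 3), (mu, 4)}"
    using assms(3) by (auto simp: Sym_pairs_def Sym_mat_def)
  have "(lam, 3) \<in> eigen_pairs A" "(mu, 4) \<in> eigen_pairs A" using ep by auto
  then have dims: "dim (eigenspace A lam) = 3" "dim (eigenspace A mu) = 4"
    by (simp_all add: eigen_pairs_def)
  obtain f :: "(real ^ 7) ^ 3" where f: "orthonormal_vec f" "\<And>x. A *v x = spectral_map lam mu f x"
    using symmetric_two_eigenspaces[OF sym assms(4), where 'k = 3] dims by auto
  define e :: "'v ^ 3" where "e = (\<chi> k. \<Sum>i\<in>UNIV. f $ k $ i *\<^sub>R b $ i)"
  have ef: "(\<chi> k i. e $ k \<bullet> b $ i) = f"
    by (simp add: vec_eq_iff e_def orthonormal_vec_inner_sum[OF assms(1)])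
  have "spectral_map lam mu f = (*v) A" using f(2) by auto
  then have "matrix_wrt b (spectral_map lam mu e) = A"
    by (simp add: matrix_wrt_spectral_map[OF assms(1,2)] ef)
  moreover have "orthonormal_vec e" using f(1) orthonormal_vec_coordinates[OF assms(1,2), of e] ef by simp
  ultimately show thesis using that by blast
qed

section \<open>Automorphisms between Cayley bases\<close>

text \<open>
The products with \<open>z\<close> are orthogonal to the span of \<open>u\<close>, \<open>v\<close>, \<open>uv\<close> because that span is closed under
the product and orthogonal to \<open>z\<close>, and multiplication by \<open>z\<close> is an isometry on it.
\<close>

lemma orthonormal_vec_cayley_basis:
  assumes vp: "vector_product m" and "cayley_triple m s"
  shows "orthonormal_vec (cayley_basis m s)"
proof -
  obtain u v z where s: "s = (u, v, z)" by (cases s) auto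
  define w where "w = m u v"
  have ct: "cayley_triple m (u, v, z)" using assms(2) s by simp
  have on: "u \<bullet> u = 1" "v \<bullet> v = 1" "w \<bullet> w = 1" "z \<bullet> z = 1"
     "u \<bullet> v = 0" "u \<bullet> w = 0" "v \<bullet> w = 0" "u \<bullet> z = 0" "v \<bullet> z = 0" "w \<bullet> z = 0"
    using ct by (simp_all add: cayley_triple_def orthonormal_4 w_def)
  then have no: "v \<bullet> u = 0" "w \<bullet> u = 0" "w \<bullet> v = 0" "z \<bullet> u = 0" "z \<bullet> v = 0" "z \<bullet> w = 0"
    by (simp_all add: inner_commute)
  note table = cayley_table_upper[OF vp ct, folded w_def]
  have wu: "m v u = - w" "m w u = v" "m w v = - u"
    using table(1,2) w_def anticommute[OF vp, of v u] anticommute[OF vp, of w u]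
      anticommute[OF vp, of w v] by simp_all
  have "m p q \<bullet> z = 0" if "p \<in> {u, v, w}" "q \<in> {u, v, w}" for p q
    using that by (elim insertE emptyE)
      (simp_all add: on table(1,2) wu w_def[symmetric] self_zero[OF vp])
  then have "m p z \<bullet> q = 0" if "p \<in> {u, v, w}" "q \<in> {u, v, w}" for p q
    using that triple_swap_23[OF vp, of p z q] by simp
  then have left: "m p z \<bullet> q = 0" if "p \<in> {u, v, w}" "q \<in> {u, v, w, z}" for p q
    using that product_orthogonal[OF vp, of p z] by blast
  have right: "m p z \<bullet> m q z = p \<bullet> q" if "p \<in> {u, v, w}" "q \<in> {u, v, w}" for p q
    using that on no inner_product_product[OF vp, of z p q]
    by (auto simp: anticommute[OF vp, of u z] anticommute[OF vp, of v z] anticommute[OF vp, of w z])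
  have left': "q \<bullet> m p z = 0" if "p \<in> {u, v, w}" "q \<in> {u, v, w, z}" for p q
    using left[OF that] by (simp add: inner_commute)
  show ?thesis
    unfolding orthonormal_vec_def forall_7 s cayley_basis_def
    by (simp add: w_def[symmetric] on no left left' right)
qed

text \<open>
The linear extension of the bijection between the two bases preserves the product because both
bases have the same multiplication table.
\<close>

lemma cayley_automorphism:
  fixes m :: "'v::euclidean_space \<Rightarrow> 'v \<Rightarrow> 'v"
  assumes dim: "DIM('v) = 7" and vp: "vector_product m"
    and cs: "cayley_triple m s" and ct: "cayley_triple m t"
  obtains g where "g \<in> G2 m" and "\<And>i. g (cayley_basis m s $ i) = cayley_basis m t $ i"
proof -
  define b where "b = cayley_basis m s"
  define c where "c = cayley_basis m t"
  have b: "orthonormal_vec b" and c: "orthonormal_vec c"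
    using orthonormal_vec_cayley_basis[OF vp] cs ct by (simp_all add: b_def c_def)
  have dim7: "DIM('v) = CARD(7)" using dim by simp
  define g where "g x = (\<Sum>k\<in>UNIV. (x \<bullet> b $ k) *\<^sub>R c $ k)" for x
  have lin: "linear g"
    by (rule linearI) (simp_all add: g_def inner_add_left scaleR_add_left sum.distrib scaleR_sum_right)
  have gb: "g (b $ i) = c $ i" for i
  proof -
    have "(b $ i \<bullet> b $ k) *\<^sub>R c $ k = (if k = i then c $ i else 0)" for k
      by (simp add: orthonormal_vec_inner[OF b])
    then show ?thesis by (simp add: g_def)
  qed
  have "g x \<bullet> g y = x \<bullet> y" for x y
  proof -
    have "g x \<bullet> c $ k = x \<bullet> b $ k" for x k
      unfolding g_def by (rule orthonormal_vec_inner_sum[OF c])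
    then show ?thesis
      using orthonormal_vec_parseval[OF c dim7, of "g x" "g y"] orthonormal_vec_parseval[OF b dim7, of x y] by simp
  qed
  then have orth: "orthogonal_transformation g"
    using lin by (simp add: orthogonal_transformation_def)
  define P where "P i j \<longleftrightarrow> g (m (b $ i) (b $ j)) = m (g (b $ i)) (g (b $ j))" for i j
  \<comment> \<open>Anticommutativity reduces the 49 products to the 21 above the diagonal.\<close>
  have diag: "P i i" for i
    by (simp add: P_def self_zero[OF vp] linear_0[OF lin])
  have sym: "P j i" if "P i j" for i j
    using that by (simp add: P_def anticommute[OF vp, of "b $ j" "b $ i"]
      anticommute[OF vp, of "g (b $ j)" "g (b $ i)"] linear_neg[OF lin])
  obtain u v z u' v' z' where st: "s = (u, v, z)" "t = (u', v', z')" by (cases s, cases t) auto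
  note table = cayley_table_upper[OF vp cs[unfolded st]] cayley_table_upper[OF vp ct[unfolded st]]
  have bv: "b $ 1 = u" "b $ 2 = v" "b $ 3 = m u v" "b $ 4 = z"
     "b $ 5 = m u z" "b $ 6 = m v z" "b $ 7 = m (m u v) z"
    by (simp_all add: b_def cayley_basis_def st)
  have g: "g u = u'" "g v = v'" "g (m u v) = m u' v'" "g z = z'"
     "g (m u z) = m u' z'" "g (m v z) = m v' z'" "g (m (m u v) z) = m (m u' v') z'"
    using gb[of 1] gb[of 2] gb[of 3] gb[of 4] gb[of 5] gb[of 6] gb[of 7]
    by (simp_all add: b_def c_def cayley_basis_def st)
  have "P 1 2" "P 1 3" "P 1 4" "P 1 5" "P 1 6" "P 1 7"
     "P 2 3" "P 2 4" "P 2 5" "P 2 6" "P 2 7" "P 3 4" "P 3 5" "P 3 6" "P 3 7"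
     "P 4 5" "P 4 6" "P 4 7" "P 5 6" "P 5 7" "P 6 7"
    unfolding P_def bv g table by (simp_all add: g linear_neg[OF lin])
  then have P: "\<forall>i j. P i j"
    unfolding forall_7 using diag sym by blast
  have bil: "bilinear m" by (rule bilin[OF vp])
  have "g (m x y) = m (g x) (g y)" for x y
  proof -
    have "bilinear (\<lambda>x y. g (m x y))" "bilinear (\<lambda>x y. m (g x) (g y))"
      using bil lin by (auto simp: bilinear_def intro: linear_compose[unfolded o_def])
    then show ?thesis
      using P orthonormal_vec_spans[OF b dim7] unfolding P_def
      by (rule_tac bilinear_eq[where S = UNIV and T = UNIV and B = "range (($) b)" and C = "range (($) b)"]) auto
  qed
  then have "g \<in> G2 m" using orth by (simp add: G2_def)
  then show thesis using gb that by (simp add: b_def c_def)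
qed

section \<open>The invariant of a three-dimensional subspace\<close>

text \<open>
An alternating trilinear form on the span of three vectors is a multiple of the determinant.
\<close>

lemma triple_change_of_basis:
  fixes e f :: "'v::euclidean_space ^ 3"
  assumes vp: "vector_product m" and f: "\<And>k. f $ k = (\<Sum>j\<in>UNIV. Q $ k $ j *\<^sub>R e $ j)"
  shows "m (f $ 1) (f $ 2) \<bullet> f $ 3 = det Q * (m (e $ 1) (e $ 2) \<bullet> e $ 3)"
proof -
  let ?T = "m (e $ 1) (e $ 2) \<bullet> e $ 3"
  have perm: "m (e $ 1) (e $ 3) \<bullet> e $ 2 = - ?T" "m (e $ 2) (e $ 1) \<bullet> e $ 3 = - ?T"
    "m (e $ 2) (e $ 3) \<bullet> e $ 1 = ?T" "m (e $ 3) (e $ 1) \<bullet> e $ 2 = ?T"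
    "m (e $ 3) (e $ 2) \<bullet> e $ 1 = - ?T"
    using triple_swap_23[OF vp, of "e $ 1" "e $ 3" "e $ 2"] triple_swap_12[OF vp, of "e $ 2" "e $ 1" "e $ 3"]
      triple_swap_23[OF vp, of "e $ 2" "e $ 3" "e $ 1"] triple_swap_12[OF vp, of "e $ 3" "e $ 1" "e $ 2"]
      triple_swap_13[OF vp, of "e $ 3" "e $ 2" "e $ 1"] by linarith+
  show ?thesis
    unfolding f sum_3 det_3
    by (simp add: bilin_simps[OF vp] self_zero[OF vp] product_orthogonal[OF vp] inner_simps perm algebra_simps)
qed

text \<open>
Equal maps have equal \<open>lam\<close>-eigenspaces, so \<open>e\<close> and \<open>f\<close> are orthonormal bases of one space and the
matrix that relates them is orthogonal.
\<close>

lemma spectral_map_triple_invariant: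
  fixes e f :: "'v::euclidean_space ^ 3"
  assumes vp: "vector_product m" and "lam \<noteq> mu" and "orthonormal_vec e" and "orthonormal_vec f"
    and eq: "spectral_map lam mu e = spectral_map lam mu f"
  shows "(m (f $ 1) (f $ 2) \<bullet> f $ 3)\<^sup>2 = (m (e $ 1) (e $ 2) \<bullet> e $ 3)\<^sup>2"
proof -
  define Q :: "real ^ 3 ^ 3" where "Q = (\<chi> k j. f $ k \<bullet> e $ j)"
  have fQ: "f $ k = (\<Sum>j\<in>UNIV. Q $ k $ j *\<^sub>R e $ j)" for k
    using spectral_map_projection_eq[OF assms(2) eq, of "f $ k"] orthonormal_vec_expansion[OF assms(4), of "f $ k"]
    by (simp add: Q_def span_base)
  have "(\<Sum>j\<in>UNIV. Q $ k $ j * Q $ l $ j) = f $ k \<bullet> f $ l" for k l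
  proof -
    have "f $ k \<bullet> f $ l = f $ k \<bullet> (\<Sum>j\<in>UNIV. Q $ l $ j *\<^sub>R e $ j)"
      by (rule arg_cong[OF fQ])
    then show ?thesis by (simp add: inner_sum_right Q_def mult.commute)
  qed
  then have "Q ** transpose Q = mat 1"
    by (simp add: vec_eq_iff matrix_matrix_mult_def transpose_def mat_def orthonormal_vec_inner[OF assms(4)])
  then have "orthogonal_matrix Q"
    using matrix_left_right_inverse by (auto simp: orthogonal_matrix_def)
  then have "(det Q)\<^sup>2 = 1" using det_orthogonal_matrix by (metis one_power2 power2_minus)
  then show ?thesis using triple_change_of_basis[OF vp fQ] by (simp add: power_mult_distrib)
qed

lemma G2_triple_invariant:
  fixes m :: "'v::euclidean_space \<Rightarrow> 'v \<Rightarrow> 'v"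
  assumes "g \<in> G2 m"
  shows "m (inv g x) (inv g y) \<bullet> inv g z = m x y \<bullet> z"
proof -
  have g: "orthogonal_transformation g" "\<And>x y. g (m x y) = m (g x) (g y)"
    using assms by (auto simp: G2_def)
  have gi: "g (inv g y) = y" for y
    by (rule surj_f_inv_f[OF orthogonal_transformation_surj[OF g(1)]])
  have "m (inv g x) (inv g y) \<bullet> inv g z = g (m (inv g x) (inv g y)) \<bullet> g (inv g z)"
    using g(1) by (simp add: orthogonal_transformation_def)
  then show ?thesis by (simp add: g(2) gi)
qed

section \<open>Representatives of the orbits\<close>

text \<open>
An orthonormal basis of the \<open>lam\<close>-eigenspace of the block diagonal matrix with parameter \<open>\<alpha>\<close>.
The sign of the sine comes from the first column \<open>(cos \<alpha>, - sin \<alpha>)\<close> of the inverse rotation.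
\<close>

definition rep_triple :: "('v::euclidean_space \<Rightarrow> 'v \<Rightarrow> 'v) \<Rightarrow> 'v \<times> 'v \<times> 'v \<Rightarrow> real \<Rightarrow> 'v ^ 3" where
  "rep_triple m = (\<lambda>(u, v, z) \<alpha>. vector [u, v, cos \<alpha> *\<^sub>R m u v - sin \<alpha> *\<^sub>R z])"

lemma orthonormal_vec_rep_triple: "cayley_triple m s \<Longrightarrow> orthonormal_vec (rep_triple m s \<alpha>)"
  by (cases s) (simp add: cayley_triple_def orthonormal_4 rep_triple_def orthonormal_vec_def forall_3
    inner_simps inner_commute power2_eq_square[symmetric])

lemma rep_triple_value:
  assumes "cayley_triple m s"
  shows "m (rep_triple m s \<alpha> $ 1) (rep_triple m s \<alpha> $ 2) \<bullet> rep_triple m s \<alpha> $ 3 = cos \<alpha>"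
  using assms by (cases s) (simp add: cayley_triple_def orthonormal_4 rep_triple_def inner_simps)

text \<open>
Given the basis \<open>e\<close> of the eigenspace, \<open>u\<close> and \<open>v\<close> are its first two members and \<open>\<alpha>\<close> is the angle
between \<open>uv\<close> and the third one, whose sign is free and is chosen to make this angle at most \<open>pi/2\<close>.
\<close>

lemma exists_rep_triple:
  fixes m :: "'v::euclidean_space \<Rightarrow> 'v \<Rightarrow> 'v" and e :: "'v ^ 3"
  assumes dim: "DIM('v) > 3" and vp: "vector_product m" and e: "orthonormal_vec e"
  obtains t \<alpha> where "cayley_triple m t" and "\<alpha> \<in> {0..pi/2}"
    and "spectral_map lam mu e = spectral_map lam mu (rep_triple m t \<alpha>)"
proof -
  define u v where "u = e $ 1" and "v = e $ 2"
  have "u \<bullet> u = 1" "v \<bullet> v = 1" "u \<bullet> v = 0"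
    using orthonormal_vec_inner[OF e] by (simp_all add: u_def v_def)
  then have "orthonormal [u, v, m u v]"
    using vp by (simp add: vector_product_def orthonormal_2)
  then have on: "u \<bullet> u = 1" "v \<bullet> v = 1" "m u v \<bullet> m u v = 1" "u \<bullet> v = 0" "u \<bullet> m u v = 0" "v \<bullet> m u v = 0"
    by (simp_all add: orthonormal_3)
  define x where "x = (if m u v \<bullet> e $ 3 \<ge> 0 then e $ 3 else - e $ 3)"
  have x: "x \<bullet> x = 1" "u \<bullet> x = 0" "v \<bullet> x = 0" "m u v \<bullet> x \<ge> 0"
    using orthonormal_vec_inner[OF e] by (auto simp: x_def u_def v_def)
  define c where "c = m u v \<bullet> x"
  have "c \<le> norm (m u v) * norm x" unfolding c_def by (rule norm_cauchy_schwarz)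
  also have "\<dots> = 1" using on(3) x(1) by (simp add: norm_eq_sqrt_inner)
  finally have c: "0 \<le> c" "c \<le> 1" using x(4) by (simp_all add: c_def)
  define \<alpha> where "\<alpha> = arccos c"
  have cos: "cos \<alpha> = c" using c by (simp add: \<alpha>_def)
  have \<alpha>: "\<alpha> \<in> {0..pi/2}"
    using c arccos_lbound[of c] arccos_le_pi2[of c] by (simp add: \<alpha>_def)
  define r where "r = x - c *\<^sub>R m u v"
  have r: "u \<bullet> r = 0" "v \<bullet> r = 0" "m u v \<bullet> r = 0"
    using x on by (simp_all add: r_def inner_diff_right c_def)
  have "r \<bullet> r = 1 - c\<^sup>2"
    using x on by (simp add: r_def inner_simps inner_commute c_def power2_eq_square algebra_simps)
  then have rr: "r \<bullet> r = (sin \<alpha>)\<^sup>2" using sin_squared_eq[of \<alpha>] by (simp add: cos)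
  obtain z where z: "z \<bullet> z = 1" "u \<bullet> z = 0" "v \<bullet> z = 0" "m u v \<bullet> z = 0" "r = - sin \<alpha> *\<^sub>R z"
  proof (cases "sin \<alpha> = 0")
    case True
    \<comment> \<open>Here the third vector is \<open>uv\<close> and imposes no condition on \<open>z\<close>; a unit vector orthogonal
      to \<open>u\<close>, \<open>v\<close>, \<open>uv\<close> exists since the dimension exceeds 3.\<close>
    have "dim {u, v, m u v} \<le> card {u, v, m u v}" by (rule dim_le_card') simp
    also have "\<dots> \<le> 3" by (simp add: card_insert_if)
    finally have "dim {u, v, m u v} < DIM('v)" using dim by simp
    then obtain y where y: "y \<noteq> 0" "\<And>x. x \<in> span {u, v, m u v} \<Longrightarrow> orthogonal y x"
      using orthogonal_to_vector_exists orthogonal_to_subspace_exists by metis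
    have "u \<bullet> y = 0" "v \<bullet> y = 0" "m u v \<bullet> y = 0"
      using y(2)[OF span_base] by (auto simp: orthogonal_def inner_commute[of _ y])
    with y(1) True rr show thesis
      by (intro that[of "y /\<^sub>R norm y"]) (simp_all add: dot_square_norm power2_eq_square field_simps)
  next
    case False
    with rr r show thesis
      by (intro that[of "- (1 / sin \<alpha>) *\<^sub>R r"]) (simp_all add: power2_eq_square field_simps)
  qed
  let ?t = "(u, v, z)"
  have ct: "cayley_triple m ?t" using on z by (simp add: cayley_triple_def orthonormal_4)
  have "x = cos \<alpha> *\<^sub>R m u v - sin \<alpha> *\<^sub>R z" using z(5) by (simp add: cos r_def algebra_simps)
  then have rep: "rep_triple m ?t \<alpha> = vector [u, v, x]" by (simp add: rep_triple_def)
  have "(y \<bullet> x) *\<^sub>R x = (y \<bullet> e $ 3) *\<^sub>R e $ 3" for y by (simp add: x_def)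
  then have "spectral_map lam mu e = spectral_map lam mu (rep_triple m ?t \<alpha>)"
    unfolding fun_eq_iff spectral_map_def sum_3 rep by (simp add: u_def v_def)
  with ct \<alpha> show thesis by (rule that)
qed

lemma matrix_inv_rot: "matrix_inv (rot \<alpha>) = rot (- \<alpha>)"
proof -
  have inv: "rot \<alpha> ** rot (- \<alpha>) = mat 1" "rot (- \<alpha>) ** rot \<alpha> = mat 1"
    by (simp_all add: rot_def vec_eq_iff forall_2 matrix_matrix_mult_def sum_2 mat_def
      power2_eq_square[symmetric] add.commute)
  show ?thesis
    unfolding matrix_inv_def
  proof (rule some_equality)
    fix B assume B: "rot \<alpha> ** B = mat 1 \<and> B ** rot \<alpha> = mat 1"
    have "B = B ** (rot \<alpha> ** rot (- \<alpha>))" by (simp add: inv)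
    also have "\<dots> = rot (- \<alpha>)" using B by (simp add: matrix_mul_assoc)
    finally show "B = rot (- \<alpha>)" .
  qed (simp add: inv)
qed

lemma matrix_wrt_rep_triple:
  fixes m :: "'v::euclidean_space \<Rightarrow> 'v \<Rightarrow> 'v"
  assumes dim: "DIM('v) = 7" and vp: "vector_product m" and ct: "cayley_triple m s"
  shows "matrix_wrt (cayley_basis m s) (spectral_map lam mu (rep_triple m s \<alpha>)) =
    block_diag (lam *\<^sub>R mat 1)
      (matrix_inv (rot \<alpha>) ** vector [vector [lam, 0], vector [0, mu]] ** rot \<alpha>) (mu *\<^sub>R mat 1)"
proof -
  let ?b = "cayley_basis m s" and ?e = "rep_triple m s \<alpha>"
  have b: "orthonormal_vec ?b" by (rule orthonormal_vec_cayley_basis[OF vp ct])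
  have e: "?e $ 1 = ?b $ 1" "?e $ 2 = ?b $ 2" "?e $ 3 = cos \<alpha> *\<^sub>R ?b $ 3 - sin \<alpha> *\<^sub>R ?b $ 4"
    by (simp_all add: rep_triple_def cayley_basis_def split: prod.split)
  have dim7: "DIM('v) = CARD(7)" using dim by simp
  have sin2: "sin \<alpha> * sin \<alpha> = 1 - cos \<alpha> * cos \<alpha>"
    using sin_squared_eq[of \<alpha>] by (simp add: power2_eq_square)
  show ?thesis
    unfolding vec_eq_iff forall_7 matrix_wrt_orthonormal[OF b dim7] inner_spectral_map sum_3 e matrix_inv_rot
    by (simp add: inner_simps orthonormal_vec_inner[OF b] block_diag_def rot_def[of \<alpha>] rot_def[of "- \<alpha>"]
      matrix_matrix_mult_def sum_2 mat_def sin2 algebra_simps)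
qed

lemma rep_triple_in_Sym_pairs:
  fixes m :: "'v::euclidean_space \<Rightarrow> 'v \<Rightarrow> 'v"
  assumes dim: "DIM('v) = 7" and vp: "vector_product m" and ct: "cayley_triple m s" and "lam \<noteq> mu"
  shows "matrix_wrt (cayley_basis m s) (spectral_map lam mu (rep_triple m s \<alpha>))
    \<in> Sym_pairs {(lam, 3), (mu, 4)}"
proof -
  let ?b = "cayley_basis m s" and ?e = "rep_triple m s \<alpha>"
  have b: "orthonormal_vec ?b" by (rule orthonormal_vec_cayley_basis[OF vp ct])
  have dim7: "DIM('v) = CARD(7)" using dim by simp
  have "orthonormal_vec (\<chi> k i. ?e $ k \<bullet> ?b $ i)"
    using orthonormal_vec_rep_triple[OF ct] by (simp add: orthonormal_vec_coordinates[OF b dim7])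
  from eigen_pairs_matrix_spectral_map[OF this assms(4)]
  show ?thesis
    using matrix_wrt_Sym_endo[OF b dim7 spectral_map_Sym_endo]
    by (simp add: Sym_pairs_def matrix_wrt_spectral_map[OF b dim7])
qed

text \<open>
A matrix determines the endomorphism \<open>\<delta>\<close> in the definition of the orbit, so the orbit is
parametrized by \<open>g\<close> alone.
\<close>

lemma G2_orbit_spectral_map:
  fixes m :: "'v::euclidean_space \<Rightarrow> 'v \<Rightarrow> 'v" and e :: "'v ^ 'k"
  assumes b: "orthonormal_vec (cayley_basis m s)" "DIM('v) = CARD(7)"
  shows "G2_orbit m s (matrix_wrt (cayley_basis m s) (spectral_map lam mu e)) =
    {matrix_wrt (cayley_basis m s) (spectral_map lam mu (\<chi> k. inv g (e $ k))) | g. g \<in> G2 m}"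
proof -
  have "\<delta> = spectral_map lam mu e"
    if "\<delta> \<in> Sym_endo" "matrix_wrt (cayley_basis m s) \<delta> = matrix_wrt (cayley_basis m s) (spectral_map lam mu e)"
    for \<delta> :: "'v \<Rightarrow> 'v"
    using matrix_wrt_inject[OF b _ linear_spectral_map that(2)] that(1) by (simp add: Sym_endo_def)
  then have "G2_orbit m s (matrix_wrt (cayley_basis m s) (spectral_map lam mu e)) =
      {matrix_wrt (cayley_basis m s) (inv g \<circ> spectral_map lam mu e \<circ> g) | g. g \<in> G2 m}"
    using spectral_map_Sym_endo[of lam mu e] unfolding G2_orbit_def by blast
  moreover have "inv g \<circ> spectral_map lam mu e \<circ> g = spectral_map lam mu (\<chi> k. inv g (e $ k))"
    if "g \<in> G2 m" for g
    using that by (intro spectral_map_conjugate) (simp add: G2_def)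
  ultimately show ?thesis by (simp add: Setcompr_eq_image cong: image_cong)
qed

lemma G2_maps_rep_triple:
  assumes "g \<in> G2 m" and "\<And>i. g (cayley_basis m s $ i) = cayley_basis m t $ i"
  shows "inv g (rep_triple m t \<alpha> $ k) = rep_triple m s \<alpha> $ k"
proof -
  have orth: "orthogonal_transformation g" using assms(1) by (simp add: G2_def)
  have lin: "linear g" using orth by (rule orthogonal_transformation_linear)
  obtain u v z u' v' z' where st: "s = (u, v, z)" "t = (u', v', z')" by (cases s, cases t) auto
  have "g u = u'" "g v = v'" "g (m u v) = m u' v'" "g z = z'"
    using assms(2)[of 1] assms(2)[of 2] assms(2)[of 3] assms(2)[of 4]
    by (simp_all add: cayley_basis_def st)
  then have "\<forall>k. g (rep_triple m s \<alpha> $ k) = rep_triple m t \<alpha> $ k"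
    by (simp add: forall_3 rep_triple_def st linear_diff[OF lin] linear_scale[OF lin])
  then show ?thesis
    using inv_f_f[OF orthogonal_transformation_inj[OF orth], of "rep_triple m s \<alpha> $ k"] by simp
qed

section \<open>The cross-section\<close>

theorem proposition3p4:
  fixes m :: "'v::euclidean_space \<Rightarrow> 'v \<Rightarrow> 'v" and s :: "'v \<times> 'v \<times> 'v" and lam mu :: real
  assumes "DIM('v) = 7" and "vector_product m" and "cayley_triple m s" and "lam \<noteq> mu"
  shows "cross_section m s {(lam, 3), (mu, 4)}
    {block_diag (lam *\<^sub>R mat 1) D (mu *\<^sub>R mat 1) | D \<alpha>.
       D = matrix_inv (rot \<alpha>) ** vector [vector [lam, 0], vector [0, mu]] ** rot \<alpha> \<and>
       \<alpha> \<in> {0..pi/2}}"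
proof -
  define b where "b = cayley_basis m s"
  define R where "R \<alpha> = matrix_wrt b (spectral_map lam mu (rep_triple m s \<alpha>))" for \<alpha>
  have b: "orthonormal_vec b" unfolding b_def by (rule orthonormal_vec_cayley_basis[OF assms(2,3)])
  have dim7: "DIM('v) = CARD(7)" and dim3: "3 < DIM('v)" using assms(1) by simp_all
  have "\<exists>!B. B \<in> R ` {0..pi/2} \<and> B \<in> G2_orbit m s A" if A: "A \<in> Sym_pairs {(lam, 3), (mu, 4)}" for A
  proof -
    obtain e :: "'v ^ 3" where e: "orthonormal_vec e" and Ae: "matrix_wrt b (spectral_map lam mu e) = A"
      using Sym_pairs_spectral_map[OF b dim7 A assms(4)] .
    have orbit: "G2_orbit m s A =
        {matrix_wrt b (spectral_map lam mu (\<chi> k. inv g (e' $ k))) | g. g \<in> G2 m}"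
      if "matrix_wrt b (spectral_map lam mu e') = A" for e' :: "'v ^ 3"
      using G2_orbit_spectral_map[OF b[unfolded b_def] dim7, of lam mu e', folded b_def] that by simp
    have inv: "(cos \<alpha>)\<^sup>2 = (m (e $ 1) (e $ 2) \<bullet> e $ 3)\<^sup>2" if in_orbit: "R \<alpha> \<in> G2_orbit m s A" for \<alpha>
    proof -
      obtain g where g: "g \<in> G2 m" and "R \<alpha> = matrix_wrt b (spectral_map lam mu (\<chi> k. inv g (e $ k)))"
        using in_orbit orbit[OF Ae] by blast
      then have eq: "spectral_map lam mu (rep_triple m s \<alpha>) = spectral_map lam mu (\<chi> k. inv g (e $ k))"
        unfolding R_def by (intro matrix_wrt_inject[OF b dim7] linear_spectral_map)
      have "orthogonal_transformation (inv g)"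
        using g by (intro orthogonal_transformation_inv) (simp add: G2_def)
      then have "orthonormal_vec (\<chi> k. inv g (e $ k))"
        using e by (simp add: orthonormal_vec_def orthogonal_transformation_def)
      from spectral_map_triple_invariant[OF assms(2,4) this orthonormal_vec_rep_triple[OF assms(3)] eq[symmetric]]
      show ?thesis by (simp add: rep_triple_value[OF assms(3)] G2_triple_invariant[OF g])
    qed
    obtain t \<alpha> where t: "cayley_triple m t" and \<alpha>: "\<alpha> \<in> {0..pi/2}"
      and et: "spectral_map lam mu e = spectral_map lam mu (rep_triple m t \<alpha>)"
      using exists_rep_triple[OF _ assms(2) e, where lam = lam and mu = mu] dim3 by metis
    obtain g where g: "g \<in> G2 m" "\<And>i. g (cayley_basis m s $ i) = cayley_basis m t $ i"
      using cayley_automorphism[OF assms(1-3) t] by blast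
    have "(\<chi> k. inv g (rep_triple m t \<alpha> $ k)) = rep_triple m s \<alpha>"
      by (simp add: vec_eq_iff G2_maps_rep_triple[OF g])
    then have "R \<alpha> \<in> G2_orbit m s A"
      using orbit[of "rep_triple m t \<alpha>"] Ae g(1) unfolding et R_def by force
    moreover have "\<beta> = \<alpha>" if "\<beta> \<in> {0..pi/2}" "R \<beta> \<in> G2_orbit m s A" for \<beta>
    proof -
      have "(cos \<beta>)\<^sup>2 = (cos \<alpha>)\<^sup>2" using inv that(2) \<open>R \<alpha> \<in> G2_orbit m s A\<close> by simp
      moreover have "cos \<beta> \<ge> 0" "cos \<alpha> \<ge> 0" using that(1) \<alpha> by (auto intro!: cos_ge_zero)
      ultimately have "cos \<beta> = cos \<alpha>" by (simp add: power2_eq_iff_nonneg)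
      then show ?thesis using that(1) \<alpha> cos_inj_pi[of \<beta> \<alpha>] by simp
    qed
    ultimately show ?thesis using \<alpha> by blast
  qed
  moreover have "R ` {0..pi/2} \<subseteq> Sym_pairs {(lam, 3), (mu, 4)}"
    unfolding R_def b_def using rep_triple_in_Sym_pairs[OF assms] by blast
  moreover have "R ` {0..pi/2} = {block_diag (lam *\<^sub>R mat 1) D (mu *\<^sub>R mat 1) | D \<alpha>.
       D = matrix_inv (rot \<alpha>) ** vector [vector [lam, 0], vector [0, mu]] ** rot \<alpha> \<and>
       \<alpha> \<in> {0..pi/2}}"
    unfolding R_def b_def matrix_wrt_rep_triple[OF assms(1-3)] by blast
  ultimately show ?thesis by (simp add: cross_section_def)
qed

end
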